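(* Let $\mathfrak{X},\mathfrak{Y},\mathfrak{Z}$ be linear spaces over $\mathbb{K}$ and let $A\subseteq\mathfrak{X}\times\mathfrak{Z}$ and $B\subseteq\mathfrak{Y}\times\mathfrak{Z}$ be two linear relations. The following statements are equivalent: (i) there exists a linear relation $C\subseteq\mathfrak{X}\times\mathfrak{Y}$ such that $A\subseteq BC$; (ii) $\mathrm{ran}\,A\subseteq\mathrm{ran}\,B$; (iii) $A\subseteq BB^{-1}A$.
   Context: $\mathbb{K}$ is $\mathbb{R}$ or $\mathbb{C}$. A linear relation between linear spaces $\mathfrak{X}$ and $\mathfrak{Y}$ is a linear subspace $R$ of $\mathfrak{X}\times\mathfrak{Y}$. Its inverse is $R^{-1}=\{(y,x):(x,y)\in R\}\subseteq\mathfrak{Y}\times\mathfrak{X}$. The range is $\mathrm{ran}\,R=\{y:(x,y)\in R\text{ for some }x\in\mathfrak{X}\}$. For linear relations $R\subseteq\mathfrak{X}\times\mathfrak{Y}$ and $S\subseteq\mathfrak{Y}\times\mathfrak{Z}$ the product is $SR=\{(x,z):(x,y)\in R\text{ and }(y,z)\in S\text{ for some }y\in\mathfrak{Y}\}\subseteq\mathfrak{X}\times\mathfrak{Z}$. *)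

theory Defs
  imports "HOL-Analysis.Product_Vector"
begin

text \<open>
  The scalar fields \<open>\<real>\<close> and \<open>\<complex>\<close>, uniformly: types that are isomorphic, as fields, to
  the real or to the complex numbers.  The types \<^typ>\<open>real\<close> and \<^typ>\<open>complex\<close>
  themselves are instances.
\<close>

class real_or_complex = field +
  assumes real_or_complex_iso:
    "(\<exists>f :: 'a \<Rightarrow> real. bij f \<and> (\<forall>a b. f (a + b) = f a + f b) \<and> (\<forall>a b. f (a * b) = f a * f b)) \<or>
     (\<exists>f :: 'a \<Rightarrow> complex. bij f \<and> (\<forall>a b. f (a + b) = f a + f b) \<and> (\<forall>a b. f (a * b) = f a * f b))"

instance real :: real_or_complex
  by standard (rule disjI1, rule exI[of _ "\<lambda>x. x"], simp add: bij_def)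

instance complex :: real_or_complex
  by standard (rule disjI2, rule exI[of _ "\<lambda>x. x"], simp add: bij_def)

definition linear_relation ::
    "('k::field \<Rightarrow> 'x::ab_group_add \<Rightarrow> 'x) \<Rightarrow> ('k \<Rightarrow> 'y::ab_group_add \<Rightarrow> 'y) \<Rightarrow> ('x \<times> 'y) set \<Rightarrow> bool"
  where "linear_relation sX sY R \<longleftrightarrow> module.subspace (module_prod.scale sX sY) R"

text \<open>
  The product \<open>S R\<close> applies \<open>R\<close> first, whereas the library's \<open>R O S\<close> lists the factors
  in the opposite order.
\<close>

abbreviation rel_prod :: "('y \<times> 'z) set \<Rightarrow> ('x \<times> 'y) set \<Rightarrow> ('x \<times> 'z) set" (infixr \<open>\<odot>\<close> 75)
  where "S \<odot> R \<equiv> R O S"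

end

theory Submission
  imports Defs
begin

text \<open>The natural candidate for \<open>C\<close> is \<open>B\<inverse> \<odot> A\<close>. A
  product with left factor \<open>B\<close> takes its values in \<open>Range B\<close>, so (i) gives
  (ii). If (ii) holds and \<open>(x, z) \<in> A\<close>, some \<open>y\<close> satisfies
  \<open>(y, z) \<in> B\<close>, and the path from \<open>x\<close> to \<open>z\<close>, back to
  \<open>y\<close> and again to \<open>z\<close> gives (iii). Finally (iii) is (i) for the
  candidate, whose linearity comes from \<open>linear_relation_converse\<close> and
  \<open>linear_relation_rel_prod\<close>.\<close>

text \<open>Addition and scaling in the product space act coordinatewise; this form lets closure be
  checked on pairs.\<close>

lemma linear_relation_iff:
  assumes "vector_space sX" and "vector_space sY"
  shows "linear_relation sX sY R \<longleftrightarrow>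
    (0, 0) \<in> R \<and>
    (\<forall>x y x' y'. (x, y) \<in> R \<longrightarrow> (x', y') \<in> R \<longrightarrow> (x + x', y + y') \<in> R) \<and>
    (\<forall>c x y. (x, y) \<in> R \<longrightarrow> (sX c x, sY c y) \<in> R)"
proof -
  interpret X: vector_space sX by fact
  interpret Y: vector_space sY by fact
  interpret P: module_prod sX sY ..
  show ?thesis
    by (simp add: linear_relation_def P.p.subspace_def P.scale_prod zero_prod_def Ball_def)
qed

lemma linear_relation_converse:
  assumes "vector_space sX" and "vector_space sY" and "linear_relation sX sY R"
  shows "linear_relation sY sX (R\<inverse>)"
  using assms(3) unfolding linear_relation_iff[OF assms(1,2)] linear_relation_iff[OF assms(2,1)]
  by simp

text \<open>Intermediate points can be added and scaled along with the endpoints: if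
  \<open>y\<close> and \<open>y'\<close> link two pairs, \<open>y + y'\<close> links their sum and
  \<open>sY c y\<close> links a multiple of the first.\<close>

lemma linear_relation_rel_prod:
  assumes "vector_space sX" and "vector_space sY" and "vector_space sZ"
    and "linear_relation sX sY R" and "linear_relation sY sZ S"
  shows "linear_relation sX sZ (S \<odot> R)"
proof -
  note R = assms(4)[unfolded linear_relation_iff[OF assms(1,2)]]
  note S = assms(5)[unfolded linear_relation_iff[OF assms(2,3)]]
  show ?thesis
    unfolding linear_relation_iff[OF assms(1,3)]
  proof (intro conjI allI impI)
    show "(0, 0) \<in> S \<odot> R"
      using R S by (meson relcompI)
  next
    fix x z x' z' assume "(x, z) \<in> S \<odot> R" "(x', z') \<in> S \<odot> R"
    then obtain y y' where "(x, y) \<in> R" "(y, z) \<in> S" "(x', y') \<in> R" "(y', z') \<in> S"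
      by (elim relcompEpair)
    then have "(x + x', y + y') \<in> R" "(y + y', z + z') \<in> S"
      using R S by simp_all
    then show "(x + x', z + z') \<in> S \<odot> R" ..
  next
    fix c x z assume "(x, z) \<in> S \<odot> R"
    then obtain y where "(x, y) \<in> R" "(y, z) \<in> S"
      by (elim relcompEpair)
    then have "(sX c x, sY c y) \<in> R" "(sY c y, sZ c z) \<in> S"
      using R S by simp_all
    then show "(sX c x, sZ c z) \<in> S \<odot> R" ..
  qed
qed

theorem theorem2p2:
  fixes sX :: "'k::real_or_complex \<Rightarrow> 'x::ab_group_add \<Rightarrow> 'x"
    and sY :: "'k \<Rightarrow> 'y::ab_group_add \<Rightarrow> 'y"
    and sZ :: "'k \<Rightarrow> 'z::ab_group_add \<Rightarrow> 'z"
    and A :: "('x \<times> 'z) set"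
    and B :: "('y \<times> 'z) set"
  assumes "vector_space sX" and "vector_space sY" and "vector_space sZ"
    and "linear_relation sX sZ A" and "linear_relation sY sZ B"
  shows "((\<exists>C. linear_relation sX sY C \<and> A \<subseteq> B \<odot> C) \<longleftrightarrow> Range A \<subseteq> Range B)
       \<and> (Range A \<subseteq> Range B \<longleftrightarrow> A \<subseteq> B \<odot> B\<inverse> \<odot> A)"
proof -
  have C: "linear_relation sX sY (B\<inverse> \<odot> A)"
    by (intro linear_relation_rel_prod[OF assms(1,3,2,4)]
        linear_relation_converse[OF assms(2,3,5)])
  have "Range A \<subseteq> Range B" if "A \<subseteq> B \<odot> C" for C :: "('x \<times> 'y) set"
    using that by blast
  moreover have "A \<subseteq> B \<odot> B\<inverse> \<odot> A" if ran: "Range A \<subseteq> Range B"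
  proof (rule subrelI)
    fix x z assume "(x, z) \<in> A"
    moreover from this obtain y where "(y, z) \<in> B"
      using ran by blast
    \<comment> \<open>The point \<open>y\<close> links \<open>x\<close> to \<open>z\<close>:
      \<open>(x, y) \<in> B\<inverse> \<odot> A\<close> passes through \<open>z\<close>, and
      \<open>(y, z) \<in> B\<close> returns there.\<close>
    ultimately show "(x, z) \<in> B \<odot> B\<inverse> \<odot> A"
      by blast
  qed
  \<comment> \<open>Since \<open>\<odot>\<close> associates to the right, (iii) literally reads
    \<open>A \<subseteq> B \<odot> C\<close> with \<open>C\<close> the relation
    \<open>B\<inverse> \<odot> A\<close>, which closes the cycle.\<close>
  ultimately show ?thesis
    using C by meson
qed

end
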